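(* Let $X$ be a Hausdorff space, let $Z$ be a Hausdorff topological vector space, let $C\subseteq Z$ be a convex and pointed cone with nonempty interior, and let $K$ be a nonempty subset of $X$. Consider mappings $f,g:K\times K\to Z$. Let $x_0\in K$ be such that $g(x_0,y)\notin-\operatorname{int} C$ for all $y\in K$, and assume that $f(x_0,x_0)\in C$. Assume further that at least one of the following statements holds. (B1) For every fixed $y\in K$, $y\ne x_0$, the map $x\mapsto f(x,y)$ is a-upper semicontinuous at $x_0$ and there exist nets $(x_\alpha),(z_\alpha)\subseteq K$ with $\lim x_\alpha=x_0$ such that $g(x_0,z_\alpha)-f(x_\alpha,y)-g(x_0,y)\in -C$ for all $\alpha$. (B2) For every fixed $y\in K$, $y\ne x_0$, the map $z\mapsto f(x_0,z)$ is a-upper semicontinuous at $y$ and there exist nets $(y_\alpha),(z_\alpha)\subseteq K$ with $\lim y_\alpha=y$ such that $g(x_0,z_\alpha)-f(x_0,y_\alpha)-g(x_0,y)\in -C$ for all $\alpha$. (B3) For every fixed $y\in K$, $y\ne x_0$, the maps $x\mapsto f(x,y)$ and $x\mapsto g(x,y)$ are a-upper semicontinuous at $x_0$ and there exist nets $(x_\alpha),(u_\alpha),(z_\alpha)\subseteq K$ with $\lim x_\alpha=x_0$, $\lim u_\alpha=x_0$ such that $g(x_0,z_\alpha)-f(x_\alpha,y)-g(u_\alpha,y)\in -C$ for all $\alpha$. (B4) For every fixed $y\in K$, $y\ne x_0$, the maps $z\mapsto f(x_0,z)$ and $z\mapsto g(x_0,z)$ are a-upper semicontinuous at $y$ and there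 exist nets $(y_\alpha),(v_\alpha),(z_\alpha)\subseteq K$ with $\lim y_\alpha=y$, $\lim v_\alpha=y$ such that $g(x_0,z_\alpha)-f(x_0,y_\alpha)-g(x_0,v_\alpha)\in -C$ for all $\alpha$. (B5) For every fixed $y\in K$, $y\ne x_0$, the map $x\mapsto f(x,y)$ is a-upper semicontinuous at $x_0$, the map $z\mapsto g(x_0,z)$ is a-upper semicontinuous at $y$, and there exist nets $(x_\alpha),(y_\alpha),(z_\alpha)\subseteq K$ with $\lim x_\alpha=x_0$, $\lim y_\alpha=y$ such that $g(x_0,z_\alpha)-f(x_\alpha,y)-g(x_0,y_\alpha)\in -C$ for all $\alpha$. (B6) For every fixed $y\in K$, $y\ne x_0$, the map $x\mapsto g(x,y)$ is a-upper semicontinuous at $x_0$, the map $z\mapsto f(x_0,z)$ is a-upper semicontinuous at $y$, and there exist nets $(x_\alpha),(y_\alpha),(z_\alpha)\subseteq K$ with $\lim x_\alpha=x_0$, $\lim y_\alpha=y$ such that $g(x_0,z_\alpha)-f(x_0,y_\alpha)-g(x_\alpha,y)\in -C$ for all $\alpha$. Then $f(x_0,y)+g(x_0,y)\notin-\operatorname{int} C$ for all $y\in K$.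
   Context: Topological vector spaces are real. A set $C\subseteq Z$ is a cone if $tc\in C$ for all $c\in C$, $t\ge 0$; it is convex if $C+C=C$ and pointed if $C\cap(-C)=\{0\}$. $\operatorname{int} C$ is the topological interior. Nets carrying the same index $\alpha$ are indexed by the same directed set. A mapping $h:K\to Z$ is almost upper semicontinuous (a-upper semicontinuous, a-usc) at $x_0\in K$ if for every net $(x_\alpha)\subseteq K$ with $\lim x_\alpha=x_0$ there exists a net $(z_\alpha)\subseteq Z$ with $\lim z_\alpha=z\in Z$ such that $h(x_\alpha)-z_\alpha\in -C$ for all $\alpha$ and $h(x_0)-z\in C$. *)

theory Defs
  imports "HOL-Analysis.Analysis"
begin

class real_topological_vector = real_vector + topological_ab_group_add +
  assumes tendsto_scaleR_Pair:
    "LIM p (nhds (t::real) \<times>\<^sub>F nhds v). fst p *\<^sub>R snd p :> nhds (t *\<^sub>R v)"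

instance real_normed_vector \<subseteq> real_topological_vector
proof
  fix t :: real and v :: 'a
  show "LIM p (nhds t \<times>\<^sub>F nhds v). fst p *\<^sub>R snd p :> nhds (t *\<^sub>R v)"
    by (intro tendsto_scaleR filterlim_fst filterlim_snd)
qed

text \<open>A net is a function on an index type, of which only the values on a directed set
  \<open>D\<close> matter; \<open>(a, b) \<in> r\<close> means that \<open>b\<close> is at or beyond \<open>a\<close>.\<close>

definition directed_set :: "'i set \<Rightarrow> 'i rel \<Rightarrow> bool" where
  "directed_set D r \<longleftrightarrow> D \<noteq> {} \<and> preorder_on D r \<and>
     (\<forall>a\<in>D. \<forall>b\<in>D. \<exists>c\<in>D. (a, c) \<in> r \<and> (b, c) \<in> r)"

text \<open>The filter generated by the tails of \<open>D\<close>: convergence along it is Moore-Smith convergence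
  (lemma \<open>tendsto_net_filter\<close>).\<close>

definition net_filter :: "'i set \<Rightarrow> 'i rel \<Rightarrow> 'i filter" where
  "net_filter D r = (INF a\<in>D. principal {b\<in>D. (a, b) \<in> r})"

lemma eventually_net_filter:
  assumes "directed_set D r"
  shows "eventually P (net_filter D r) \<longleftrightarrow> (\<exists>a\<in>D. \<forall>b\<in>D. (a, b) \<in> r \<longrightarrow> P b)"
proof -
  have tr: "trans r"
    using assms by (simp add: directed_set_def preorder_on_def)
  have "eventually P (net_filter D r) \<longleftrightarrow>
      (\<exists>a\<in>D. eventually P (principal {b\<in>D. (a, b) \<in> r}))"
    unfolding net_filter_def
  proof (rule eventually_INF_base)
    show "D \<noteq> {}"
      using assms by (simp add: directed_set_def)
  next
    fix a b assume "a \<in> D" "b \<in> D"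
    then obtain c where c: "c \<in> D" "(a, c) \<in> r" "(b, c) \<in> r"
      using assms unfolding directed_set_def by blast
    have "{x\<in>D. (c, x) \<in> r} \<subseteq> {x\<in>D. (a, x) \<in> r} \<inter> {x\<in>D. (b, x) \<in> r}"
      using c tr by (blast dest: transD)
    with c(1) show "\<exists>x\<in>D. principal {b\<in>D. (x, b) \<in> r}
        \<le> inf (principal {x\<in>D. (a, x) \<in> r}) (principal {x\<in>D. (b, x) \<in> r})"
      by (auto intro!: bexI[of _ c])
  qed
  then show ?thesis
    by (auto simp: eventually_principal)
qed

lemma tendsto_net_filter:
  assumes "directed_set D r"
  shows "(x \<longlongrightarrow> l) (net_filter D r) \<longleftrightarrow>
    (\<forall>U. open U \<longrightarrow> l \<in> U \<longrightarrow> (\<exists>a\<in>D. \<forall>b\<in>D. (a, b) \<in> r \<longrightarrow> x b \<in> U))"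
  by (simp add: tendsto_def eventually_net_filter[OF assms])

text \<open>Almost upper semicontinuity at \<open>x0\<close> of the restriction of \<open>h\<close> to \<open>K\<close>. HOL cannot quantify
  over all index types inside a formula, so the nets considered are those whose directed set is a
  subset of the type \<open>'i\<close> (with an arbitrary direction); a statement that keeps \<open>'i\<close> as a type
  variable covers nets over arbitrary directed sets. Note that for sets \<open>- C\<close> denotes the
  complement, so the cone of negatives is written as an image.\<close>

definition a_usc_at ::
    "'i itself \<Rightarrow> 'z::real_topological_vector set \<Rightarrow> 'x::topological_space set \<Rightarrow>
     ('x \<Rightarrow> 'z) \<Rightarrow> 'x \<Rightarrow> bool" where
  "a_usc_at (_ :: 'i itself) C K h x0 \<longleftrightarrow>
     (\<forall>(D::'i set) r x. directed_set D r \<and> x \<in> D \<rightarrow> K \<and> (x \<longlongrightarrow> x0) (net_filter D r) \<longrightarrow>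
        (\<exists>\<zeta> z. (\<zeta> \<longlongrightarrow> z) (net_filter D r) \<and>
           (\<forall>a\<in>D. h (x a) - \<zeta> a \<in> uminus ` C) \<and> h x0 - z \<in> C))"

end

theory Submission
  imports Defs
begin

text \<open>If \<open>f x0 y + g x0 y\<close> were in \<open>- interior C\<close>, then so would be the limit of the sum of the
  two majorizing nets given by almost upper semicontinuity, as \<open>interior C + C \<subseteq> interior C\<close>. Since
  \<open>- interior C\<close> is open, some sum of the majorants lies in it, and the net condition
  pushes \<open>g x0 (\<zeta> a)\<close> into \<open>- interior C\<close> for the corresponding index \<open>a\<close>, which is excluded. A fixed
  summand (B1, B2) is a constant map, and \<open>y = x0\<close> is direct.\<close>

lemma mem_uminus_image_iff: "x \<in> uminus ` S \<longleftrightarrow> - x \<in> S" for x :: "'a::group_add"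
  by force

text \<open>The translate of \<open>interior C\<close> by \<open>c\<close> is open, contains
  \<open>x + c\<close> and lies in \<open>C + C\<close>, hence in \<open>C\<close>. Writing the
  translate as a preimage under \<open>w - c\<close> gives its openness from continuity of
  subtraction.\<close>

lemma add_mem_interior:
  fixes C :: "'a::topological_ab_group_add set"
  assumes "C + C = C" and "x \<in> interior C" and "c \<in> C"
  shows "x + c \<in> interior C"
proof (rule interiorI)
  show "open ((\<lambda>w. w - c) -` interior C)"
    by (intro open_vimage open_interior continuous_intros)
  show "x + c \<in> (\<lambda>w. w - c) -` interior C"
    using assms(2) by simp
  show "(\<lambda>w. w - c) -` interior C \<subseteq> C"
  proof
    fix w assume "w \<in> (\<lambda>w. w - c) -` interior C"
    then have "w - c \<in> C"
      using interior_subset by auto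
    from set_plus_intro[OF this assms(3)] assms(1) show "w \<in> C"
      by simp
  qed
qed

text \<open>By reflexivity every index belongs to its own tail, so no tail is empty. This is what
  turns a property holding eventually along the net into an actual index.\<close>

lemma net_filter_neq_bot:
  assumes "directed_set D r"
  shows "net_filter D r \<noteq> bot"
proof -
  have "refl_on D r"
    using assms by (simp add: directed_set_def preorder_on_def)
  then show ?thesis
    unfolding trivial_limit_def eventually_net_filter[OF assms] by (auto dest: refl_onD)
qed

lemma eventually_in_net_filter:
  assumes "directed_set D r"
  shows "eventually (\<lambda>a. a \<in> D) (net_filter D r)"
  using assms by (auto simp: eventually_net_filter directed_set_def)

lemma a_usc_at_const:
  assumes "0 \<in> C"
  shows "a_usc_at TYPE('i) C K (\<lambda>_. c) x"
  unfolding a_usc_at_def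
proof (intro allI impI)
  fix D :: "'i set" and r and y :: "'i \<Rightarrow> 'b"
  show "\<exists>\<zeta> z. (\<zeta> \<longlongrightarrow> z) (net_filter D r) \<and>
      (\<forall>a\<in>D. c - \<zeta> a \<in> uminus ` C) \<and> c - z \<in> C"
    \<comment> \<open>The constant net majorizes the constant map exactly: both differences vanish,
      and only \<open>0\<close> has to be in the cone.\<close>
    using assms by (intro exI[of _ "\<lambda>_. c"] exI[of _ c]) (auto simp: mem_uminus_image_iff)
qed

text \<open>Common core of the six alternatives: \<open>p\<close> and \<open>q\<close> are sections
  of \<open>f\<close> and \<open>g\<close> with one argument frozen, or a constant, and
  \<open>w\<close> is the net of values \<open>g x0 (\<zeta> a)\<close>. The base points
  \<open>x\<close> and \<open>y\<close> are independent, which allows the mixed alternatives; the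
  two nets share \<open>D\<close>, so their majorants can be added index by index.\<close>

lemma a_usc_sum_notin:
  fixes C :: "'z::real_topological_vector set"
  assumes CC: "C + C = C"
    and usc: "a_usc_at TYPE('i) C K p x" "a_usc_at TYPE('i) C K q y"
    and D: "directed_set (D::'i set) r"
    and K: "\<xi> \<in> D \<rightarrow> K" "\<eta> \<in> D \<rightarrow> K"
    and lim: "(\<xi> \<longlongrightarrow> x) (net_filter D r)" "(\<eta> \<longlongrightarrow> y) (net_filter D r)"
    and le: "\<forall>a\<in>D. w a - p (\<xi> a) - q (\<eta> a) \<in> uminus ` C"
    and w: "\<forall>a\<in>D. w a \<notin> uminus ` interior C"
  shows "p x + q y \<notin> uminus ` interior C"
proof
  assume "p x + q y \<in> uminus ` interior C"
  then have sum: "- (p x + q y) \<in> interior C"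
    by (simp only: mem_uminus_image_iff)
  obtain \<phi> s where \<phi>: "(\<phi> \<longlongrightarrow> s) (net_filter D r)"
      "\<forall>a\<in>D. p (\<xi> a) - \<phi> a \<in> uminus ` C" "p x - s \<in> C"
    using usc(1) D K(1) lim(1) unfolding a_usc_at_def by blast
  obtain \<psi> t where \<psi>: "(\<psi> \<longlongrightarrow> t) (net_filter D r)"
      "\<forall>a\<in>D. q (\<eta> a) - \<psi> a \<in> uminus ` C" "q y - t \<in> C"
    using usc(2) D K(2) lim(2) unfolding a_usc_at_def by blast
  \<comment> \<open>Adding the two cone elements cancels \<open>p x\<close> and \<open>q y\<close>,
    leaving the negated limit of the summed majorants.\<close>
  have "- (p x + q y) + (p x - s) + (q y - t) \<in> interior C"
    by (intro add_mem_interior[OF CC] sum \<phi>(3) \<psi>(3))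
  then have "- (s + t) \<in> interior C"
    by (simp add: algebra_simps)
  moreover have "((\<lambda>a. - (\<phi> a + \<psi> a)) \<longlongrightarrow> - (s + t)) (net_filter D r)"
    by (intro tendsto_intros \<phi>(1) \<psi>(1))
  ultimately have "eventually (\<lambda>a. - (\<phi> a + \<psi> a) \<in> interior C) (net_filter D r)"
    using open_interior by (blast dest: topological_tendstoD)
  \<comment> \<open>Membership in \<open>D\<close> is recorded as well, since the cone conditions
    are available only for indices there.\<close>
  then have "eventually (\<lambda>a. a \<in> D \<and> - (\<phi> a + \<psi> a) \<in> interior C) (net_filter D r)"
    using eventually_in_net_filter[OF D] by (simp add: eventually_conj_iff)
  then obtain a where a: "a \<in> D" "- (\<phi> a + \<psi> a) \<in> interior C"
    using eventually_happens'[OF net_filter_neq_bot[OF D]] by blast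
  have "- (p (\<xi> a) - \<phi> a) \<in> C" "- (q (\<eta> a) - \<psi> a) \<in> C" "- (w a - p (\<xi> a) - q (\<eta> a)) \<in> C"
    using a(1) \<phi>(2) \<psi>(2) le by (simp_all only: mem_uminus_image_iff)
  \<comment> \<open>The sum telescopes to \<open>- w a\<close>: the first two cone elements replace
    the majorants by \<open>p (\<xi> a)\<close> and \<open>q (\<eta> a)\<close>, and the third
    replaces these by \<open>w a\<close>.\<close>
  then have "- (\<phi> a + \<psi> a) + - (p (\<xi> a) - \<phi> a) + - (q (\<eta> a) - \<psi> a)
      + - (w a - p (\<xi> a) - q (\<eta> a)) \<in> interior C"
    by (intro add_mem_interior[OF CC] a(2))
  then have "- w a \<in> interior C"
    by (simp add: algebra_simps)
  with w a(1) show False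
    by (simp add: mem_uminus_image_iff)
qed

theorem theorem4p6:
  fixes C :: "'z::{real_topological_vector, t2_space} set"
    and K :: "'x::t2_space set"
    and f g :: "'x \<Rightarrow> 'x \<Rightarrow> 'z"
    and x0 :: 'x
  assumes "cone C" and "C + C = C" and "C \<inter> uminus ` C = {0}" and "interior C \<noteq> {}"
    and "K \<noteq> {}" and "x0 \<in> K"
    and "\<forall>y\<in>K. g x0 y \<notin> uminus ` interior C"
    and "f x0 x0 \<in> C"
    and "
      (\<forall>y\<in>K. y \<noteq> x0 \<longrightarrow>
        a_usc_at TYPE('i) C K (\<lambda>w. f w y) x0 \<and>
        (\<exists>(D::'i set) r \<xi> \<zeta>. directed_set D r \<and>
          \<xi> \<in> D \<rightarrow> K \<and> \<zeta> \<in> D \<rightarrow> K \<and>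
          (\<xi> \<longlongrightarrow> x0) (net_filter D r) \<and>
          (\<forall>a\<in>D. g x0 (\<zeta> a) - f (\<xi> a) y - g x0 y \<in> uminus ` C))) \<or>
      (\<forall>y\<in>K. y \<noteq> x0 \<longrightarrow>
        a_usc_at TYPE('i) C K (\<lambda>w. f x0 w) y \<and>
        (\<exists>(D::'i set) r \<eta> \<zeta>. directed_set D r \<and>
          \<eta> \<in> D \<rightarrow> K \<and> \<zeta> \<in> D \<rightarrow> K \<and>
          (\<eta> \<longlongrightarrow> y) (net_filter D r) \<and>
          (\<forall>a\<in>D. g x0 (\<zeta> a) - f x0 (\<eta> a) - g x0 y \<in> uminus ` C))) \<or>
      (\<forall>y\<in>K. y \<noteq> x0 \<longrightarrow>
        a_usc_at TYPE('i) C K (\<lambda>w. f w y) x0 \<and>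
        a_usc_at TYPE('i) C K (\<lambda>w. g w y) x0 \<and>
        (\<exists>(D::'i set) r \<xi> \<mu> \<zeta>. directed_set D r \<and>
          \<xi> \<in> D \<rightarrow> K \<and> \<mu> \<in> D \<rightarrow> K \<and> \<zeta> \<in> D \<rightarrow> K \<and>
          (\<xi> \<longlongrightarrow> x0) (net_filter D r) \<and> (\<mu> \<longlongrightarrow> x0) (net_filter D r) \<and>
          (\<forall>a\<in>D. g x0 (\<zeta> a) - f (\<xi> a) y - g (\<mu> a) y \<in> uminus ` C))) \<or>
      (\<forall>y\<in>K. y \<noteq> x0 \<longrightarrow>
        a_usc_at TYPE('i) C K (\<lambda>w. f x0 w) y \<and>
        a_usc_at TYPE('i) C K (\<lambda>w. g x0 w) y \<and>
        (\<exists>(D::'i set) r \<eta> \<nu> \<zeta>. directed_set D r \<and>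
          \<eta> \<in> D \<rightarrow> K \<and> \<nu> \<in> D \<rightarrow> K \<and> \<zeta> \<in> D \<rightarrow> K \<and>
          (\<eta> \<longlongrightarrow> y) (net_filter D r) \<and> (\<nu> \<longlongrightarrow> y) (net_filter D r) \<and>
          (\<forall>a\<in>D. g x0 (\<zeta> a) - f x0 (\<eta> a) - g x0 (\<nu> a) \<in> uminus ` C))) \<or>
      (\<forall>y\<in>K. y \<noteq> x0 \<longrightarrow>
        a_usc_at TYPE('i) C K (\<lambda>w. f w y) x0 \<and>
        a_usc_at TYPE('i) C K (\<lambda>w. g x0 w) y \<and>
        (\<exists>(D::'i set) r \<xi> \<eta> \<zeta>. directed_set D r \<and>
          \<xi> \<in> D \<rightarrow> K \<and> \<eta> \<in> D \<rightarrow> K \<and> \<zeta> \<in> D \<rightarrow> K \<and>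
          (\<xi> \<longlongrightarrow> x0) (net_filter D r) \<and> (\<eta> \<longlongrightarrow> y) (net_filter D r) \<and>
          (\<forall>a\<in>D. g x0 (\<zeta> a) - f (\<xi> a) y - g x0 (\<eta> a) \<in> uminus ` C))) \<or>
      (\<forall>y\<in>K. y \<noteq> x0 \<longrightarrow>
        a_usc_at TYPE('i) C K (\<lambda>w. g w y) x0 \<and>
        a_usc_at TYPE('i) C K (\<lambda>w. f x0 w) y \<and>
        (\<exists>(D::'i set) r \<xi> \<eta> \<zeta>. directed_set D r \<and>
          \<xi> \<in> D \<rightarrow> K \<and> \<eta> \<in> D \<rightarrow> K \<and> \<zeta> \<in> D \<rightarrow> K \<and>
          (\<xi> \<longlongrightarrow> x0) (net_filter D r) \<and> (\<eta> \<longlongrightarrow> y) (net_filter D r) \<and>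
          (\<forall>a\<in>D. g x0 (\<zeta> a) - f x0 (\<eta> a) - g (\<xi> a) y \<in> uminus ` C)))"
  shows "\<forall>y\<in>K. f x0 y + g x0 y \<notin> uminus ` interior C"
proof
  have zero: "0 \<in> C"
    using assms(3) by blast
  have w: "\<forall>a\<in>D. g x0 (\<zeta> a) \<notin> uminus ` interior C" if "\<zeta> \<in> D \<rightarrow> K" for D :: "'i set" and \<zeta>
    using that assms(7) by blast
  note core = a_usc_sum_notin[OF assms(2)]
  fix y assume y: "y \<in> K"
  show "f x0 y + g x0 y \<notin> uminus ` interior C"
  proof (cases "y = x0")
    case True
    show ?thesis
    proof
      assume "f x0 y + g x0 y \<in> uminus ` interior C"
      \<comment> \<open>Adding \<open>f x0 x0\<close>, an element of the cone, leaves
        \<open>- g x0 x0\<close> in the interior, which is excluded because \<open>x0\<close> lies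
        in \<open>K\<close>.\<close>
      then have "- (f x0 x0 + g x0 x0) + f x0 x0 \<in> interior C"
        using True by (intro add_mem_interior[OF assms(2)] assms(8)) (simp only: mem_uminus_image_iff)
      then show False
        using assms(6,7) by (simp add: mem_uminus_image_iff)
    qed
  next
    case False
    from assms(9) show ?thesis
    proof (elim disjE, goal_cases)
      case 1
      then obtain D :: "'i set" and r \<xi> \<zeta> where n:
          "a_usc_at TYPE('i) C K (\<lambda>w. f w y) x0"
          "directed_set D r" "\<xi> \<in> D \<rightarrow> K" "\<zeta> \<in> D \<rightarrow> K"
          "(\<xi> \<longlongrightarrow> x0) (net_filter D r)"
          "\<forall>a\<in>D. g x0 (\<zeta> a) - f (\<xi> a) y - g x0 y \<in> uminus ` C"
        using y False by blast
      show ?case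
        \<comment> \<open>The second map is the constant \<open>g x0 y\<close>, for which any
          convergent net will do; \<open>\<xi>\<close> with its limit \<open>x0\<close> is used
          again, hence the repeated facts.\<close>
        using core[OF n(1) a_usc_at_const[OF zero] n(2) n(3) n(3) n(5) n(5) n(6) w[OF n(4)]] .
    next
      case 2
      then obtain D :: "'i set" and r \<eta> \<zeta> where n:
          "a_usc_at TYPE('i) C K (\<lambda>w. f x0 w) y"
          "directed_set D r" "\<eta> \<in> D \<rightarrow> K" "\<zeta> \<in> D \<rightarrow> K"
          "(\<eta> \<longlongrightarrow> y) (net_filter D r)"
          "\<forall>a\<in>D. g x0 (\<zeta> a) - f x0 (\<eta> a) - g x0 y \<in> uminus ` C"
        using y False by blast
      show ?case
        \<comment> \<open>Here the net reused for the constant \<open>g x0 y\<close> is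
          \<open>\<eta>\<close>, with limit \<open>y\<close>.\<close>
        using core[OF n(1) a_usc_at_const[OF zero] n(2) n(3) n(3) n(5) n(5) n(6) w[OF n(4)]] .
    next
      case 3
      then obtain D :: "'i set" and r \<xi> \<mu> \<zeta> where n:
          "a_usc_at TYPE('i) C K (\<lambda>w. f w y) x0" "a_usc_at TYPE('i) C K (\<lambda>w. g w y) x0"
          "directed_set D r" "\<xi> \<in> D \<rightarrow> K" "\<mu> \<in> D \<rightarrow> K" "\<zeta> \<in> D \<rightarrow> K"
          "(\<xi> \<longlongrightarrow> x0) (net_filter D r)" "(\<mu> \<longlongrightarrow> x0) (net_filter D r)"
          "\<forall>a\<in>D. g x0 (\<zeta> a) - f (\<xi> a) y - g (\<mu> a) y \<in> uminus ` C"
        using y False by blast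
      show ?case
        using core[OF n(1) n(2) n(3) n(4) n(5) n(7) n(8) n(9) w[OF n(6)]] .
    next
      case 4
      then obtain D :: "'i set" and r \<eta> \<nu> \<zeta> where n:
          "a_usc_at TYPE('i) C K (\<lambda>w. f x0 w) y" "a_usc_at TYPE('i) C K (\<lambda>w. g x0 w) y"
          "directed_set D r" "\<eta> \<in> D \<rightarrow> K" "\<nu> \<in> D \<rightarrow> K" "\<zeta> \<in> D \<rightarrow> K"
          "(\<eta> \<longlongrightarrow> y) (net_filter D r)" "(\<nu> \<longlongrightarrow> y) (net_filter D r)"
          "\<forall>a\<in>D. g x0 (\<zeta> a) - f x0 (\<eta> a) - g x0 (\<nu> a) \<in> uminus ` C"
        using y False by blast
      show ?case
        using core[OF n(1) n(2) n(3) n(4) n(5) n(7) n(8) n(9) w[OF n(6)]] .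
    next
      case 5
      then obtain D :: "'i set" and r \<xi> \<eta> \<zeta> where n:
          "a_usc_at TYPE('i) C K (\<lambda>w. f w y) x0" "a_usc_at TYPE('i) C K (\<lambda>w. g x0 w) y"
          "directed_set D r" "\<xi> \<in> D \<rightarrow> K" "\<eta> \<in> D \<rightarrow> K" "\<zeta> \<in> D \<rightarrow> K"
          "(\<xi> \<longlongrightarrow> x0) (net_filter D r)" "(\<eta> \<longlongrightarrow> y) (net_filter D r)"
          "\<forall>a\<in>D. g x0 (\<zeta> a) - f (\<xi> a) y - g x0 (\<eta> a) \<in> uminus ` C"
        using y False by blast
      show ?case
        using core[OF n(1) n(2) n(3) n(4) n(5) n(7) n(8) n(9) w[OF n(6)]] .
    next
      case 6
      \<comment> \<open>The facts about \<open>f\<close> are listed before those about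
        \<open>g\<close>, and those about \<open>\<eta>\<close> before those about
        \<open>\<xi>\<close>, so that \<open>f\<close> takes the place of \<open>p\<close> and the
        conclusion has its summands in the required order.\<close>
      then obtain D :: "'i set" and r \<xi> \<eta> \<zeta> where n:
          "a_usc_at TYPE('i) C K (\<lambda>w. f x0 w) y" "a_usc_at TYPE('i) C K (\<lambda>w. g w y) x0"
          "directed_set D r" "\<eta> \<in> D \<rightarrow> K" "\<xi> \<in> D \<rightarrow> K" "\<zeta> \<in> D \<rightarrow> K"
          "(\<eta> \<longlongrightarrow> y) (net_filter D r)" "(\<xi> \<longlongrightarrow> x0) (net_filter D r)"
          "\<forall>a\<in>D. g x0 (\<zeta> a) - f x0 (\<eta> a) - g (\<xi> a) y \<in> uminus ` C"
        using y False by blast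
      show ?case
        using core[OF n(1) n(2) n(3) n(4) n(5) n(7) n(8) n(9) w[OF n(6)]] .
    qed
  qed
qed

end
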